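(* Let $(\mathfrak g,[\cdot,\cdot,\cdot]_{\mathfrak g})$ be a $3$-Lie algebra, $(V;\rho)$ a representation of $\mathfrak g$, $\Phi$ a $2$-cocycle on $\mathfrak g$ with coefficients in $(V;\rho)$, and let $T:V\to\mathfrak g$ be a $\Phi$-twisted Rota-Baxter operator on $\mathfrak g$ with respect to $(V;\rho)$. Then $$\{u_1,u_2,u_3\}=\rho(Tu_1,Tu_2)u_3\quad\text{and}\quad[u_1,u_2,u_3]=\Phi(Tu_1,Tu_2,Tu_3),\qquad u_1,u_2,u_3\in V,$$ defines an NS-$3$-Lie algebra structure on $V$.
   Context: All vector spaces are over a fixed field. A 3-Lie algebra is a vector space $\mathfrak g$ with a skew-symmetric trilinear map $[\cdot,\cdot,\cdot]_{\mathfrak g}$ (i.e. a linear map $\wedge^3\mathfrak g\to\mathfrak g$) such that for all $x_1,\dots,x_5\in\mathfrak g$: $[x_1,x_2,[x_3,x_4,x_5]_{\mathfrak g}]_{\mathfrak g}=[[x_1,x_2,x_3]_{\mathfrak g},x_4,x_5]_{\mathfrak g}+[x_3,[x_1,x_2,x_4]_{\mathfrak g},x_5]_{\mathfrak g}+[x_3,x_4,[x_1,x_2,x_5]_{\mathfrak g}]_{\mathfrak g}$. A representation of $\mathfrak g$ is a pair $(V;\rho)$ with $V$ a vector space and $\rho:\wedge^2\mathfrak g\to\mathfrak{gl}(V)$ linear such that for all $x_1,\dots,x_4\in\mathfrak g$: (i) $[\rho(x_1,x_2),\rho(x_3,x_4)]=\rho([x_1,x_2,x_3]_{\mathfrak g},x_4)+\rho(x_3,[x_1,x_2,x_4]_{\mathfrak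 g})$ (commutator on the left); (ii) $\rho([x_1,x_2,x_3]_{\mathfrak g},x_4)=\rho(x_1,x_2)\rho(x_3,x_4)+\rho(x_2,x_3)\rho(x_1,x_4)+\rho(x_3,x_1)\rho(x_2,x_4)$. A 2-cocycle on $\mathfrak g$ with coefficients in $(V;\rho)$ is a linear map $\Phi:\wedge^3\mathfrak g\to V$ such that for all $x_1,\dots,x_5\in\mathfrak g$: $\Phi(x_1,x_2,[x_3,x_4,x_5]_{\mathfrak g})-\Phi([x_1,x_2,x_3]_{\mathfrak g},x_4,x_5)-\Phi(x_3,[x_1,x_2,x_4]_{\mathfrak g},x_5)-\Phi(x_3,x_4,[x_1,x_2,x_5]_{\mathfrak g})+\rho(x_1,x_2)\Phi(x_3,x_4,x_5)-\rho(x_3,x_4)\Phi(x_1,x_2,x_5)-\rho(x_4,x_5)\Phi(x_1,x_2,x_3)-\rho(x_5,x_3)\Phi(x_1,x_2,x_4)=0$. A $\Phi$-twisted Rota-Baxter operator on $\mathfrak g$ with respect to $(V;\rho)$ is a linear map $T:V\to\mathfrak g$ with $[Tu,Tv,Tw]_{\mathfrak g}=T\big(\rho(Tu,Tv)w+\rho(Tv,Tw)u+\rho(Tw,Tu)v+\Phi(Tu,Tv,Tw)\big)$ for all $u,v,w\in V$. An NS-3-Lie algebra is a vector space $A$ with two linear maps $\{\cdot,\cdot,\cdot\},[\cdot,\cdot,\cdot]:A\otimes A\otimes A\to A$, with $[\cdot,\cdot,\cdot]$ skew-symmetric, such that, with $[\![x,y,z]\!]:=\{x,y,z\}+\{y,z,x\}+\{z,x,y\}+[x,y,z]$,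 for all $x_1,\dots,x_5\in A$: (1) $\{x_1,x_2,x_3\}=-\{x_2,x_1,x_3\}$; (2) $\{x_1,x_2,\{x_3,x_4,x_5\}\}=\{x_3,x_4,\{x_1,x_2,x_5\}\}+\{[\![x_1,x_2,x_3]\!],x_4,x_5\}+\{x_3,[\![x_1,x_2,x_4]\!],x_5\}$; (3) $\{[\![x_1,x_2,x_3]\!],x_4,x_5\}=\{x_1,x_2,\{x_3,x_4,x_5\}\}+\{x_2,x_3,\{x_1,x_4,x_5\}\}+\{x_3,x_1,\{x_2,x_4,x_5\}\}$; (4) $[x_1,x_2,[\![x_3,x_4,x_5]\!]]=[x_3,x_4,[\![x_1,x_2,x_5]\!]]+[x_4,x_5,[\![x_1,x_2,x_3]\!]]+[x_5,x_3,[\![x_1,x_2,x_4]\!]]-\{x_1,x_2,[x_3,x_4,x_5]\}+\{x_3,x_4,[x_1,x_2,x_5]\}+\{x_4,x_5,[x_1,x_2,x_3]\}+\{x_5,x_3,[x_1,x_2,x_4]\}$. *)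

theory Defs
  imports Complex_Main
begin

text \<open>
  A linear map out of a threefold tensor product is represented by the trilinear function it
  corresponds to; the arguments \<open>sa\<close>, \<open>sb\<close>, \<open>sc\<close>, \<open>sd\<close> are the scalar multiplications of the
  vector spaces involved.
\<close>

definition trilinear ::
  "('k::field \<Rightarrow> 'a::ab_group_add \<Rightarrow> 'a) \<Rightarrow> ('k \<Rightarrow> 'b::ab_group_add \<Rightarrow> 'b) \<Rightarrow>
   ('k \<Rightarrow> 'c::ab_group_add \<Rightarrow> 'c) \<Rightarrow> ('k \<Rightarrow> 'd::ab_group_add \<Rightarrow> 'd) \<Rightarrow>
   ('a \<Rightarrow> 'b \<Rightarrow> 'c \<Rightarrow> 'd) \<Rightarrow> bool"
  where "trilinear sa sb sc sd f \<longleftrightarrow>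
    (\<forall>y z. Vector_Spaces.linear sa sd (\<lambda>x. f x y z)) \<and>
    (\<forall>x z. Vector_Spaces.linear sb sd (\<lambda>y. f x y z)) \<and>
    (\<forall>x y. Vector_Spaces.linear sc sd (\<lambda>z. f x y z))"

text \<open>
  Skew-symmetry of a trilinear map means that it factors through the third exterior power, i.e.
  that it vanishes as soon as two arguments coincide. In characteristic 2 this is stronger
  than the change of sign under transpositions, which it always implies (see below).
\<close>

definition skew_trilinear ::
  "('k::field \<Rightarrow> 'a::ab_group_add \<Rightarrow> 'a) \<Rightarrow> ('k \<Rightarrow> 'b::ab_group_add \<Rightarrow> 'b) \<Rightarrow>
   ('a \<Rightarrow> 'a \<Rightarrow> 'a \<Rightarrow> 'b) \<Rightarrow> bool"
  where "skew_trilinear sa sb f \<longleftrightarrow> trilinear sa sa sa sb f \<and>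
    (\<forall>x y. f x x y = 0) \<and> (\<forall>x y. f x y x = 0) \<and> (\<forall>x y. f y x x = 0)"

lemma skew_trilinear_swap:
  assumes "skew_trilinear sa sb f"
  shows "f y x z = - f x y z" "f x z y = - f x y z" "f z y x = - f x y z"
proof -
  have lin: "f (a + b) c d = f a c d + f b c d" "f c (a + b) d = f c a d + f c b d"
    "f c d (a + b) = f c d a + f c d b" for a b c d
    using assms by (auto simp: skew_trilinear_def trilinear_def Vector_Spaces.linear_iff)
  have alt: "f a a b = 0" "f a b a = 0" "f b a a = 0" for a b
    using assms by (auto simp: skew_trilinear_def)
  show "f y x z = - f x y z"
    using alt(1)[of "x + y" z] unfolding lin by (simp add: alt add_eq_0_iff)
  show "f x z y = - f x y z"
    using alt(3)[of x "y + z"] unfolding lin by (simp add: alt add_eq_0_iff)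
  show "f z y x = - f x y z"
    using alt(2)[of "x + z" y] unfolding lin by (simp add: alt add_eq_0_iff)
qed

locale three_Lie_algebra = vector_space scale
  for scale :: "'k::field \<Rightarrow> 'g::ab_group_add \<Rightarrow> 'g"
  + fixes br :: "'g \<Rightarrow> 'g \<Rightarrow> 'g \<Rightarrow> 'g"
  assumes br_skew: "skew_trilinear scale scale br"
    and br_fundamental:
      "br x1 x2 (br x3 x4 x5)
       = br (br x1 x2 x3) x4 x5 + br x3 (br x1 x2 x4) x5 + br x3 x4 (br x1 x2 x5)"

text \<open>
  A linear map from the second exterior power of the algebra to \<open>gl(V)\<close> is given uncurried:
  \<open>\<rho> x y v\<close> is the endomorphism \<open>\<rho>(x, y)\<close> of \<open>V\<close> applied to \<open>v\<close>. Trilinearity then expresses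
  both the linearity of each \<open>\<rho>(x, y)\<close> and the bilinearity of \<open>\<rho>\<close>. The two identities between
  endomorphisms are stated pointwise.
\<close>

locale three_Lie_representation =
  three_Lie_algebra scale br + V: vector_space scaleV
  for scale :: "'k::field \<Rightarrow> 'g::ab_group_add \<Rightarrow> 'g"
    and br :: "'g \<Rightarrow> 'g \<Rightarrow> 'g \<Rightarrow> 'g"
    and scaleV :: "'k \<Rightarrow> 'v::ab_group_add \<Rightarrow> 'v"
  + fixes \<rho> :: "'g \<Rightarrow> 'g \<Rightarrow> 'v \<Rightarrow> 'v"
  assumes rho_trilinear: "trilinear scale scale scaleV scaleV \<rho>"
    and rho_alternating: "\<rho> x x v = 0"
    and rho_commutator:
      "\<rho> x1 x2 (\<rho> x3 x4 v) - \<rho> x3 x4 (\<rho> x1 x2 v) = \<rho> (br x1 x2 x3) x4 v + \<rho> x3 (br x1 x2 x4) v"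
    and rho_bracket:
      "\<rho> (br x1 x2 x3) x4 v
       = \<rho> x1 x2 (\<rho> x3 x4 v) + \<rho> x2 x3 (\<rho> x1 x4 v) + \<rho> x3 x1 (\<rho> x2 x4 v)"

locale three_Lie_2_cocycle =
  three_Lie_representation scale br scaleV \<rho>
  for scale :: "'k::field \<Rightarrow> 'g::ab_group_add \<Rightarrow> 'g"
    and br :: "'g \<Rightarrow> 'g \<Rightarrow> 'g \<Rightarrow> 'g"
    and scaleV :: "'k \<Rightarrow> 'v::ab_group_add \<Rightarrow> 'v"
    and \<rho> :: "'g \<Rightarrow> 'g \<Rightarrow> 'v \<Rightarrow> 'v"
  + fixes \<Phi> :: "'g \<Rightarrow> 'g \<Rightarrow> 'g \<Rightarrow> 'v"
  assumes cocycle_skew: "skew_trilinear scale scaleV \<Phi>"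
    and cocycle_identity:
      "\<Phi> x1 x2 (br x3 x4 x5) - \<Phi> (br x1 x2 x3) x4 x5 - \<Phi> x3 (br x1 x2 x4) x5
       - \<Phi> x3 x4 (br x1 x2 x5) + \<rho> x1 x2 (\<Phi> x3 x4 x5) - \<rho> x3 x4 (\<Phi> x1 x2 x5)
       - \<rho> x4 x5 (\<Phi> x1 x2 x3) - \<rho> x5 x3 (\<Phi> x1 x2 x4) = 0"

locale twisted_Rota_Baxter_operator =
  three_Lie_2_cocycle scale br scaleV \<rho> \<Phi> + T: Vector_Spaces.linear scaleV scale T
  for scale :: "'k::field \<Rightarrow> 'g::ab_group_add \<Rightarrow> 'g"
    and br :: "'g \<Rightarrow> 'g \<Rightarrow> 'g \<Rightarrow> 'g"
    and scaleV :: "'k \<Rightarrow> 'v::ab_group_add \<Rightarrow> 'v"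
    and \<rho> :: "'g \<Rightarrow> 'g \<Rightarrow> 'v \<Rightarrow> 'v"
    and \<Phi> :: "'g \<Rightarrow> 'g \<Rightarrow> 'g \<Rightarrow> 'v"
    and T :: "'v \<Rightarrow> 'g"
  + assumes Rota_Baxter:
      "br (T u) (T v) (T w)
       = T (\<rho> (T u) (T v) w + \<rho> (T v) (T w) u + \<rho> (T w) (T u) v + \<Phi> (T u) (T v) (T w))"

definition NS_total ::
  "('a \<Rightarrow> 'a \<Rightarrow> 'a \<Rightarrow> 'a::ab_group_add) \<Rightarrow> ('a \<Rightarrow> 'a \<Rightarrow> 'a \<Rightarrow> 'a) \<Rightarrow> 'a \<Rightarrow> 'a \<Rightarrow> 'a \<Rightarrow> 'a"
  where "NS_total cur sq x y z = cur x y z + cur y z x + cur z x y + sq x y z"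

text \<open>
  Here \<open>cur\<close> and \<open>sq\<close> are the operations written with curly and with square brackets, and
  \<open>NS_total cur sq\<close> is the one written with double square brackets.
\<close>

locale NS_three_Lie_algebra = vector_space scale
  for scale :: "'k::field \<Rightarrow> 'a::ab_group_add \<Rightarrow> 'a"
  + fixes cur :: "'a \<Rightarrow> 'a \<Rightarrow> 'a \<Rightarrow> 'a"
    and sq :: "'a \<Rightarrow> 'a \<Rightarrow> 'a \<Rightarrow> 'a"
  assumes cur_trilinear: "trilinear scale scale scale scale cur"
    and sq_skew: "skew_trilinear scale scale sq"
    and NS1: "cur x1 x2 x3 = - cur x2 x1 x3"
    and NS2: "cur x1 x2 (cur x3 x4 x5)
      = cur x3 x4 (cur x1 x2 x5)
        + cur (NS_total cur sq x1 x2 x3) x4 x5 + cur x3 (NS_total cur sq x1 x2 x4) x5"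
    and NS3: "cur (NS_total cur sq x1 x2 x3) x4 x5
      = cur x1 x2 (cur x3 x4 x5) + cur x2 x3 (cur x1 x4 x5) + cur x3 x1 (cur x2 x4 x5)"
    and NS4: "sq x1 x2 (NS_total cur sq x3 x4 x5)
      = sq x3 x4 (NS_total cur sq x1 x2 x5)
        + sq x4 x5 (NS_total cur sq x1 x2 x3)
        + sq x5 x3 (NS_total cur sq x1 x2 x4)
        - cur x1 x2 (sq x3 x4 x5) + cur x3 x4 (sq x1 x2 x5)
        + cur x4 x5 (sq x1 x2 x3) + cur x5 x3 (sq x1 x2 x4)"

end

(*
  The twisted Rota-Baxter identity says that T carries the double square bracket of the two
  operations to the bracket of the 3-Lie algebra. Axioms (2) and (3) are then the two
  representation axioms, and axiom (4) is the cocycle identity, evaluated on the image of T.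
*)
theory Submission
  imports Defs
begin

text \<open>A separate linear map is allowed in each slot because the curly operation is
  \<open>\<rho>\<close> with \<open>T\<close> inserted in its first two arguments only.\<close>

lemma trilinear_compose:
  assumes "trilinear sa sb sc sd f"
    and "Vector_Spaces.linear ra sa p" "Vector_Spaces.linear rb sb q" "Vector_Spaces.linear rc sc r"
  shows "trilinear ra rb rc sd (\<lambda>x y z. f (p x) (q y) (r z))"
  using assms by (simp add: trilinear_def Vector_Spaces.linear_iff)

lemma skew_trilinear_compose:
  assumes "skew_trilinear sa sb f" "Vector_Spaces.linear ra sa p"
  shows "skew_trilinear ra sb (\<lambda>x y z. f (p x) (p y) (p z))"
  using assms trilinear_compose[of sa sa sa sb f ra p ra p ra p] by (simp add: skew_trilinear_def)

text \<open>A 3-cycle is a product of two transpositions, so the two signs cancel.\<close>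

lemma skew_trilinear_cyclic:
  assumes "skew_trilinear sa sb f"
  shows "f y z x = f x y z"
  using skew_trilinear_swap(1)[OF assms, of x y z] skew_trilinear_swap(2)[OF assms, of y x z]
  by simp

context three_Lie_representation
begin

text \<open>Polarization: expanding \<open>\<rho> (x + y) (x + y) v = 0\<close> leaves only the two
  mixed terms. This supplies the first NS axiom.\<close>

lemma rho_skew: "\<rho> x y v = - \<rho> y x v"
proof -
  have lin: "\<rho> (a + b) c v = \<rho> a c v + \<rho> b c v" "\<rho> c (a + b) v = \<rho> c a v + \<rho> c b v" for a b c
    using rho_trilinear by (auto simp: trilinear_def Vector_Spaces.linear_iff)
  show ?thesis
    using rho_alternating[of "x + y" v] unfolding lin by (simp add: rho_alternating eq_neg_iff_add_eq_0 add.commute)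
qed

end

context twisted_Rota_Baxter_operator
begin

abbreviation induced_curly :: "'v \<Rightarrow> 'v \<Rightarrow> 'v \<Rightarrow> 'v"
  where "induced_curly \<equiv> \<lambda>u v w. \<rho> (T u) (T v) w"

abbreviation induced_square :: "'v \<Rightarrow> 'v \<Rightarrow> 'v \<Rightarrow> 'v"
  where "induced_square \<equiv> \<lambda>u v w. \<Phi> (T u) (T v) (T w)"

lemma T_NS_total: "T (NS_total induced_curly induced_square u v w) = br (T u) (T v) (T w)"
  by (simp add: NS_total_def Rota_Baxter)

lemma induced_NS_three_Lie_algebra:
  "NS_three_Lie_algebra scaleV induced_curly induced_square"
\<comment> \<open>Each double bracket in the axioms sits in one of the first two slots of the curly
  operation or in a slot of the square one. It is therefore always under \<open>T\<close>, and the
  unfolding turns it into \<open>br\<close>.\<close>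
proof (unfold_locales, unfold T_NS_total)
  show "trilinear scaleV scaleV scaleV scaleV induced_curly"
    \<comment> \<open>The third argument is already a vector of V, so the map inserted there is the
      identity.\<close>
    using trilinear_compose[OF rho_trilinear T.linear_axioms T.linear_axioms V.linear_id] by simp
  show "skew_trilinear scaleV scaleV induced_square"
    using cocycle_skew T.linear_axioms by (rule skew_trilinear_compose)
  fix x1 x2 x3 x4 x5
  show "\<rho> (T x1) (T x2) x3 = - \<rho> (T x2) (T x1) x3"
    by (rule rho_skew)
  show "\<rho> (T x1) (T x2) (\<rho> (T x3) (T x4) x5)
    = \<rho> (T x3) (T x4) (\<rho> (T x1) (T x2) x5)
      + \<rho> (br (T x1) (T x2) (T x3)) (T x4) x5 + \<rho> (T x3) (br (T x1) (T x2) (T x4)) x5"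
    using rho_commutator[of "T x1" "T x2" "T x3" "T x4" x5] by (simp add: algebra_simps)
  show "\<rho> (br (T x1) (T x2) (T x3)) (T x4) x5
    = \<rho> (T x1) (T x2) (\<rho> (T x3) (T x4) x5) + \<rho> (T x2) (T x3) (\<rho> (T x1) (T x4) x5)
      + \<rho> (T x3) (T x1) (\<rho> (T x2) (T x4) x5)"
    by (rule rho_bracket)
  \<comment> \<open>The cocycle identity has these inner brackets in the first and the middle slot,
    whereas the fourth NS axiom has them in the last. The two rotations run in opposite directions,
    which is why the cyclic rule is also needed in its symmetric form.\<close>
  have "\<Phi> (T x4) (T x5) (br (T x1) (T x2) (T x3)) = \<Phi> (br (T x1) (T x2) (T x3)) (T x4) (T x5)"
    "\<Phi> (T x5) (T x3) (br (T x1) (T x2) (T x4)) = \<Phi> (T x3) (br (T x1) (T x2) (T x4)) (T x5)"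
    by (rule skew_trilinear_cyclic[OF cocycle_skew]
        skew_trilinear_cyclic[OF cocycle_skew, symmetric])+
  then show "\<Phi> (T x1) (T x2) (br (T x3) (T x4) (T x5))
    = \<Phi> (T x3) (T x4) (br (T x1) (T x2) (T x5)) + \<Phi> (T x4) (T x5) (br (T x1) (T x2) (T x3))
      + \<Phi> (T x5) (T x3) (br (T x1) (T x2) (T x4)) - \<rho> (T x1) (T x2) (\<Phi> (T x3) (T x4) (T x5))
      + \<rho> (T x3) (T x4) (\<Phi> (T x1) (T x2) (T x5)) + \<rho> (T x4) (T x5) (\<Phi> (T x1) (T x2) (T x3))
      + \<rho> (T x5) (T x3) (\<Phi> (T x1) (T x2) (T x4))"
    using cocycle_identity[of "T x1" "T x2" "T x3" "T x4" "T x5"] by (simp add: algebra_simps)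
qed

end

theorem theorem3p4:
  fixes scale :: "'k::field \<Rightarrow> 'g::ab_group_add \<Rightarrow> 'g"
    and br :: "'g \<Rightarrow> 'g \<Rightarrow> 'g \<Rightarrow> 'g"
    and scaleV :: "'k \<Rightarrow> 'v::ab_group_add \<Rightarrow> 'v"
    and \<rho> :: "'g \<Rightarrow> 'g \<Rightarrow> 'v \<Rightarrow> 'v"
    and \<Phi> :: "'g \<Rightarrow> 'g \<Rightarrow> 'g \<Rightarrow> 'v"
    and T :: "'v \<Rightarrow> 'g"
  assumes "three_Lie_algebra scale br"
    and "three_Lie_representation scale br scaleV \<rho>"
    and "three_Lie_2_cocycle scale br scaleV \<rho> \<Phi>"
    and "twisted_Rota_Baxter_operator scale br scaleV \<rho> \<Phi> T"
  shows "NS_three_Lie_algebra scaleV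
           (\<lambda>u1 u2 u3. \<rho> (T u1) (T u2) u3)
           (\<lambda>u1 u2 u3. \<Phi> (T u1) (T u2) (T u3))"
  using assms(4) by (rule twisted_Rota_Baxter_operator.induced_NS_three_Lie_algebra)

end
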